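(* Let $T$ be a rank-one transformation and let $n$ be a nonzero integer. Then $T^n\times T^{-n}$ is conservative (with respect to the product measure).
   Context: Rank-one transformations. A column is a finite ordered collection of pairwise disjoint intervals (levels) of equal length; its column map sends each level to the next one up by translation. A rank-one (cutting-and-stacking) transformation $T$ is given by columns $C_0,C_1,\dots$ where $C_0$ is the single level $[0,1]$ and $C_{m+1}$ is obtained from $C_m$ by cutting $C_m$ into $r_m\ge 2$ subcolumns of equal width, placing $s_{m,k}\ge 0$ new levels (spacers) above the $k$-th subcolumn ($0\le k\le r_m-1$), and stacking every subcolumn under the one to its right. $X=\bigcup_m C_m$ carries Lebesgue measure $\mu$ (finite or infinite), and $T$ is the pointwise limit of the column maps (an invertible measure-preserving transformation, mod null sets). An invertible measure-preserving transformation $S$ is conservative if $A\subset\bigcup_{m=1}^\infty S^{-m}(A)$ up to a null set for every measurable set $A$. *)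

theory Defs
  imports "HOL-Analysis.Analysis"
begin

text \<open>
  A column is given by the common width \<open>w\<close> of its levels and the list \<open>c\<close> of the left
  endpoints of its levels, from bottom to top.  Levels are half-open, so that cutting a
  level produces honestly disjoint intervals; this changes the construction by a countable
  set only.
\<close>

definition level :: "real \<Rightarrow> real \<Rightarrow> real set" where
  "level w a = {a..<a + w}"

definition disjoint_levels :: "real \<Rightarrow> real list \<Rightarrow> bool" where
  "disjoint_levels w c \<longleftrightarrow>
     (\<forall>i<length c. \<forall>j<length c. i \<noteq> j \<longrightarrow> level w (c ! i) \<inter> level w (c ! j) = {})"

definition column_support :: "real \<Rightarrow> real list \<Rightarrow> real set" where
  "column_support w c = (\<Union>a\<in>set c. level w a)"

text \<open>The column map is not defined on the top level, so it is given by its graph.\<close>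

definition column_map :: "real \<Rightarrow> real list \<Rightarrow> (real \<times> real) set" where
  "column_map w c =
     {(x, x + (c ! Suc j - c ! j)) | x j. Suc j < length c \<and> x \<in> level w (c ! j)}"

text \<open>
  Cut the column into \<open>r\<close> subcolumns of width \<open>w / r\<close>, put the spacers with left endpoints
  \<open>sp k\<close> (in upward order) above the \<open>k\<close>-th subcolumn, and stack, the leftmost subcolumn at
  the bottom.
\<close>

definition cut_and_stack ::
    "nat \<Rightarrow> real \<Rightarrow> real list \<Rightarrow> (nat \<Rightarrow> real list) \<Rightarrow> real list" where
  "cut_and_stack r w c sp =
     concat (map (\<lambda>k. map (\<lambda>a. a + real k * (w / real r)) c @ sp k) [0..<r])"

primrec width :: "(nat \<Rightarrow> nat) \<Rightarrow> nat \<Rightarrow> real" where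
  "width r 0 = 1"
| "width r (Suc m) = width r m / real (r m)"

primrec column :: "(nat \<Rightarrow> nat) \<Rightarrow> (nat \<Rightarrow> nat \<Rightarrow> real list) \<Rightarrow> nat \<Rightarrow> real list" where
  "column r sp 0 = [0]"
| "column r sp (Suc m) = cut_and_stack (r m) (width r m) (column r sp m) (sp m)"

text \<open>
  The spacer number \<open>s\<^sub>m\<^sub>,\<^sub>k\<close> is \<open>length (sp m k)\<close>, which may be 0.  Disjointness of the levels
  of column \<open>Suc m\<close> says in particular that the spacers are new, since the cut levels of
  column \<open>m\<close> cover the support of column \<open>m\<close>.
\<close>

definition rank_one_construction ::
    "(nat \<Rightarrow> nat) \<Rightarrow> (nat \<Rightarrow> nat \<Rightarrow> real list) \<Rightarrow> bool" where
  "rank_one_construction r sp \<longleftrightarrow>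
     (\<forall>m. r m \<ge> 2) \<and> (\<forall>m. disjoint_levels (width r m) (column r sp m))"

definition rank_one_set :: "(nat \<Rightarrow> nat) \<Rightarrow> (nat \<Rightarrow> nat \<Rightarrow> real list) \<Rightarrow> real set" where
  "rank_one_set r sp = (\<Union>m. column_support (width r m) (column r sp m))"

abbreviation rank_one_space ::
    "(nat \<Rightarrow> nat) \<Rightarrow> (nat \<Rightarrow> nat \<Rightarrow> real list) \<Rightarrow> real measure" where
  "rank_one_space r sp \<equiv> lebesgue_on (rank_one_set r sp)"

text \<open>
  Each column map extends the preceding ones, so their pointwise limit is an eventual value.
  As \<open>T\<close> is only determined modulo null sets, every measurable self-map of the space that
  agrees almost everywhere with this limit is admitted.
\<close>

definition rank_one_transformation ::
    "(nat \<Rightarrow> nat) \<Rightarrow> (nat \<Rightarrow> nat \<Rightarrow> real list) \<Rightarrow> (real \<Rightarrow> real) \<Rightarrow> bool" where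
  "rank_one_transformation r sp T \<longleftrightarrow>
     rank_one_construction r sp \<and>
     T \<in> rank_one_space r sp \<rightarrow>\<^sub>M rank_one_space r sp \<and>
     (AE x in rank_one_space r sp.
        \<forall>\<^sub>F m in sequentially. (x, T x) \<in> column_map (width r m) (column r sp m))"

definition inverse_mod_null :: "'a measure \<Rightarrow> ('a \<Rightarrow> 'a) \<Rightarrow> ('a \<Rightarrow> 'a) \<Rightarrow> bool" where
  "inverse_mod_null M T T' \<longleftrightarrow>
     T' \<in> M \<rightarrow>\<^sub>M M \<and> (AE x in M. T' (T x) = x) \<and> (AE x in M. T (T' x) = x)"

text \<open>\<open>T\<^sup>n\<close> for an integer \<open>n\<close>, where \<open>T'\<close> is an inverse of \<open>T\<close> (modulo null sets).\<close>

definition int_iterate :: "('a \<Rightarrow> 'a) \<Rightarrow> ('a \<Rightarrow> 'a) \<Rightarrow> int \<Rightarrow> 'a \<Rightarrow> 'a" where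
  "int_iterate T T' n = (if n \<ge> 0 then T ^^ nat n else T' ^^ nat (- n))"

definition conservative :: "'a measure \<Rightarrow> ('a \<Rightarrow> 'a) \<Rightarrow> bool" where
  "conservative M S \<longleftrightarrow>
     (\<forall>A\<in>sets M. A - (\<Union>m\<in>{1..}. (S ^^ m) -` A \<inter> space M) \<in> null_sets M)"

end

theory Submission imports Defs begin

text \<open>
  Write \<open>S\<close> for the product map and let \<open>B\<close> be the set of those points of a given set that
  never return to it, so that no point of \<open>B\<close> returns to \<open>B\<close> under an iterate \<open>S\<^sup>k\<close>, \<open>k \<ge> 1\<close>.
  It has to be shown that \<open>B\<close> is null.

  Take two levels \<open>I\<close> and \<open>J\<close> of column \<open>m\<close>, at heights \<open>i\<close> and \<open>j\<close>.  A later column \<open>N\<close>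
  contains disjoint copies of column \<open>m\<close>, starting at certain positions \<open>a \<in> D\<close>, and
  the rectangle \<open>I \<times> J\<close> is cut into equal small rectangles \<open>(a, b)\<close>, formed by the levels
  \<open>i + a\<close> and \<open>j + b\<close> of column \<open>N\<close> (lemma \<open>copies\<close>).  If \<open>b - a = n k\<close> with \<open>k \<ge> 1\<close>, then
  \<open>S\<^sup>k\<close> adds \<open>b - a\<close> to the first height and subtracts it from the second, so it translates the
  rectangle \<open>(a, b)\<close> onto the rectangle \<open>(b, a)\<close>.  As \<open>B\<close> does not meet its image, its parts in
  \<open>(a, b)\<close> and \<open>(b, a)\<close> together have at most the measure of one small rectangle
  (\<open>wandering_swap\<close>).  The opposite signs of the two exponents are what makes this symmetry work.

  Once there are at least \<open>2 |n|\<close> copies, the pigeonhole principle yields a fixed proportion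
  of pairs \<open>a \<noteq> b\<close> that are congruent modulo \<open>|n|\<close> (\<open>sum_pairs_le_if_congruent_swap\<close>).  Hence
  \<open>B\<close> misses a proportion of at least \<open>1 / (4 n\<^sup>2)\<close> of every rectangle \<open>I \<times> J\<close>, at every stage
  (\<open>wandering_sparse\<close>).  These rectangles become arbitrarily small around every point, so \<open>B\<close>
  has no density points and is null (\<open>negligible_if_uniformly_sparse\<close>).
\<close>

section \<open>Uniformly sparse sets are null\<close>

text \<open>
  A substitute for the Lebesgue density theorem along arbitrary fine families \<open>Q m\<close>: enclose
  \<open>B\<close> in an open \<open>U\<close> of nearly the same measure.  The members of \<open>Q m\<close> inside \<open>U\<close> eventually
  catch every point of \<open>B\<close>, so \<open>|B| \<le> c |U|\<close>, and \<open>|U|\<close> is as close to \<open>|B|\<close> as desired.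
\<close>

lemma negligible_if_uniformly_sparse:
  fixes B :: "'a::euclidean_space set" and Q :: "nat \<Rightarrow> 'a set set"
  assumes B: "B \<in> lmeasurable"
    and fin: "\<And>m. finite (Q m)"
    and meas: "\<And>m K. K \<in> Q m \<Longrightarrow> K \<in> lmeasurable"
    and disj: "\<And>m. pairwise disjnt (Q m)"
    and fine: "\<And>U z. open U \<Longrightarrow> z \<in> U \<Longrightarrow> z \<in> B \<Longrightarrow>
                 \<forall>\<^sub>F m in sequentially. \<exists>K\<in>Q m. z \<in> K \<and> K \<subseteq> U"
    and sparse: "\<And>m K. K \<in> Q m \<Longrightarrow> measure lebesgue (B \<inter> K) \<le> c * measure lebesgue K"
    and c: "0 \<le> c" "c < 1"
  shows "negligible B"
proof -
  have approx: "measure lebesgue B \<le> c * (measure lebesgue B + e)" if "e > 0" for e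
  proof -
    obtain U where U: "open U" "B \<subseteq> U" "U - B \<in> lmeasurable"
        "emeasure lebesgue (U - B) < ennreal e"
      using sets_lebesgue_outer_open[of B e] B \<open>e > 0\<close> by blast
    have UB: "U = B \<union> (U - B)" using U(2) by blast
    have Um: "U \<in> lmeasurable" using B U(3) UB fmeasurable.Un by metis
    have "measure lebesgue (U - B) < e"
      using U(3,4) \<open>e > 0\<close> by (simp add: emeasure_eq_measure2 ennreal_less_iff)
    then have Ule: "measure lebesgue U \<le> measure lebesgue B + e"
      using measure_Un_le[of B lebesgue "U - B"] B U(3) UB by (smt (verit) fmeasurableD)
    \<comment> \<open>The sets \<open>\<Union>(F m)\<close> need not increase with \<open>m\<close>; passing to tail intersections restores monotonicity.\<close>
    define F where "F m = {K\<in>Q m. K \<subseteq> U}" for m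
    define G where "G m = (\<Inter>m'\<in>{m..}. B \<inter> \<Union>(F m'))" for m
    have FQ: "finite (F m)" "F m \<subseteq> Q m" for m using fin by (auto simp: F_def)
    have FM: "\<Union>(F m) \<in> lmeasurable" for m
      by (intro fmeasurable.finite_Union FQ) (use FQ meas in blast)
    have BF: "measure lebesgue (B \<inter> \<Union>(F m)) \<le> c * measure lebesgue U" for m
    proof -
      have "measure lebesgue (B \<inter> \<Union>(F m)) = measure lebesgue (\<Union>K\<in>F m. B \<inter> K)"
        by (simp only: Int_Union)
      also have "\<dots> \<le> (\<Sum>K\<in>F m. measure lebesgue (B \<inter> K))"
        using FQ[of m] meas[of _ m] B by (intro measure_UNION_le) (auto simp: fmeasurableD)
      also have "\<dots> \<le> (\<Sum>K\<in>F m. c * measure lebesgue K)"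
        using FQ(2)[of m] by (intro sum_mono sparse) auto
      also have "\<dots> = c * measure lebesgue (\<Union>(F m))"
        using FQ[of m] meas[of _ m] pairwise_subset[OF disj[of m] FQ(2)[of m]]
        by (subst measure_Union') (auto simp: sum_distrib_left)
      also have "\<dots> \<le> c * measure lebesgue U"
        using FM[of m] Um c
        by (intro mult_left_mono measure_mono_fmeasurable) (auto simp: F_def)
      finally show ?thesis .
    qed
    have Gm: "G m \<in> lmeasurable" for m
    proof (rule fmeasurableI2[OF B])
      show "G m \<in> sets lebesgue" unfolding G_def
        using B FM by (intro sets.countable_INT') (auto intro!: sets.Int fmeasurableD)
    qed (auto simp: G_def)
    have "G m \<subseteq> B \<inter> \<Union>(F m)" for m by (auto simp: G_def)
    then have GU: "measure lebesgue (G m) \<le> c * measure lebesgue U" for m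
      using BF[of m] Gm[of m] FM[of m] B
      by (meson measure_mono_fmeasurable fmeasurable.Int fmeasurableD order_trans)
    have GB: "(\<Union>m. G m) = B"
    proof (intro equalityI subsetI)
      fix z assume z: "z \<in> B"
      obtain m where "\<forall>m'\<ge>m. \<exists>K\<in>Q m'. z \<in> K \<and> K \<subseteq> U"
        using fine[OF U(1) _ z] U(2) z by (auto simp: eventually_sequentially)
      then have "z \<in> G m" using z by (force simp: G_def F_def)
      then show "z \<in> (\<Union>m. G m)" by blast
    qed (auto simp: G_def)
    have "(\<lambda>m. measure lebesgue (G m)) \<longlonglongrightarrow> measure lebesgue (\<Union>m. G m)"
    proof (rule Lim_measure_incseq)
      show "range G \<subseteq> sets lebesgue" using Gm by (auto simp: fmeasurableD)
      show "incseq G" by (auto simp: incseq_def G_def)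
      show "emeasure lebesgue (\<Union>m. G m) \<noteq> \<infinity>"
        unfolding GB using fmeasurableD2[OF B] by simp
    qed
    then have "measure lebesgue B \<le> c * measure lebesgue U"
      using GU by (auto simp: GB intro: LIMSEQ_le_const2)
    also have "\<dots> \<le> c * (measure lebesgue B + e)"
      using Ule c by (intro mult_left_mono) auto
    finally show ?thesis .
  qed
  have "measure lebesgue B \<le> c * measure lebesgue B + e" if "e > 0" for e
  proof -
    have "c * e \<le> e" using mult_right_mono[of c 1 e] c that by simp
    then show ?thesis using approx[OF that] by (simp add: distrib_left)
  qed
  then have "measure lebesgue B \<le> c * measure lebesgue B" by (rule field_le_epsilon)
  moreover have "c * measure lebesgue B < measure lebesgue B" if "measure lebesgue B > 0"
    using c that by simp
  ultimately have "measure lebesgue B = 0"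
    using measure_nonneg[of lebesgue B] by linarith
  then show ?thesis using B negligible_iff_measure by blast
qed

section \<open>Lebesgue measure on products\<close>

lemma negligible_cylinder:
  fixes N :: "'a::euclidean_space set"
  assumes "negligible N"
  shows "negligible (N \<times> (UNIV :: 'b::euclidean_space set))"
    and "negligible ((UNIV :: 'b set) \<times> N)"
proof -
  obtain N' where N': "N' \<in> null_sets lborel" "N \<subseteq> N'"
    using assms unfolding negligible_iff_null_sets null_sets_completion_iff2 by blast
  have "N' \<times> (UNIV :: 'b set) \<in> null_sets (lborel \<Otimes>\<^sub>M lborel)"
       "(UNIV :: 'b set) \<times> N' \<in> null_sets (lborel \<Otimes>\<^sub>M lborel)"
    using N' by (auto simp: null_sets_def lborel.emeasure_pair_measure_Times)
  then have "N' \<times> (UNIV :: 'b set) \<in> null_sets lborel" "(UNIV :: 'b set) \<times> N' \<in> null_sets lborel"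
    by (simp_all add: lborel_prod)
  then have "N' \<times> (UNIV :: 'b set) \<in> null_sets lebesgue" "(UNIV :: 'b set) \<times> N' \<in> null_sets lebesgue"
    by (simp_all add: null_sets_completionI)
  then show "negligible (N \<times> (UNIV :: 'b set))" "negligible ((UNIV :: 'b set) \<times> N)"
    unfolding negligible_iff_null_sets[symmetric] using N'(2)
    by (metis negligible_subset Sigma_mono order_refl)+
qed

lemma AE_lebesgue_negligible: "(AE x in lebesgue. P x) \<longleftrightarrow> negligible {x. \<not> P x}"
  by (simp add: completion.AE_iff_null_sets negligible_iff_null_sets)

lemma AE_lebesgue_prod:
  fixes P :: "'a::euclidean_space \<Rightarrow> bool" and Q :: "'b::euclidean_space \<Rightarrow> bool"
  assumes "AE x in lebesgue. P x" "AE y in lebesgue. Q y"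
  shows "AE z in lebesgue. P (fst z) \<and> Q (snd z)"
proof -
  have "{z. \<not> (P (fst z) \<and> Q (snd z))} = {x. \<not> P x} \<times> UNIV \<union> UNIV \<times> {y. \<not> Q y}" by auto
  then show ?thesis
    using assms unfolding AE_lebesgue_negligible by (metis negligible_Un negligible_cylinder)
qed

lemma AE_lebesgue_translate:
  fixes d :: "'a::euclidean_space"
  assumes "AE x in lebesgue. P x"
  shows "AE x in lebesgue. P (x + d)"
proof -
  have "{x. \<not> P (x + d)} = (+) (- d) ` {x. \<not> P x}"
    by (auto simp: image_iff intro!: exI[of _ "_ + d"])
  then show ?thesis
    using assms negligible_translation[of "{x. \<not> P x}" "- d"] by (simp add: AE_lebesgue_negligible)
qed

lemma sets_lebesgue_Times:
  fixes A :: "'a::euclidean_space set" and B :: "'b::euclidean_space set"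
  assumes "A \<in> sets lebesgue" "B \<in> sets lebesgue"
  shows "A \<times> B \<in> sets lebesgue"
proof -
  obtain S N where A: "A = S \<union> N" "negligible N" "S \<in> sets borel"
    using assms(1) by (metis sets_completionE sets_lborel negligible_iff_null_sets null_sets_completionI negligible_subset)
  obtain S' N' where B: "B = S' \<union> N'" "negligible N'" "S' \<in> sets borel"
    using assms(2) by (metis sets_completionE sets_lborel negligible_iff_null_sets null_sets_completionI negligible_subset)
  have "S \<times> S' \<in> sets lborel"
    using A(3) B(3) by (simp add: borel_prod[symmetric])
  moreover have "negligible (A \<times> B - S \<times> S')"
    by (rule negligible_subset[of "N \<times> UNIV \<union> UNIV \<times> N'"])
      (auto simp: A B negligible_cylinder)
  moreover have "A \<times> B = S \<times> S' \<union> (A \<times> B - S \<times> S')" using A(1) B(1) by auto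
  ultimately show ?thesis
    by (metis negligible_imp_sets sets.Un sets_completionI_sets)
qed

text \<open>
  The product of two Lebesgue spaces is not complete, but it is contained in planar Lebesgue
  measure.  This lemma and \<open>null_sets_pair_lebesgue_on\<close> below allow the proof to be carried out
  for planar Lebesgue measure, where translations and outer regularity are available, and its
  conclusion to be transferred back.
\<close>

lemma sets_pair_lebesgue_on:
  fixes X :: "'a::euclidean_space set" and Y :: "'b::euclidean_space set"
  assumes X: "X \<in> sets lebesgue" and Y: "Y \<in> sets lebesgue"
    and B: "B \<in> sets (lebesgue_on X \<Otimes>\<^sub>M lebesgue_on Y)"
  shows "B \<in> sets lebesgue"
proof -
  let ?R = "restrict_space lebesgue (X \<times> Y) :: ('a \<times> 'b) measure"
  have XY: "X \<times> Y \<in> sets lebesgue" using X Y by (rule sets_lebesgue_Times)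
  have eq: "{A \<times> B |A B. A \<in> sets (lebesgue_on X) \<and> B \<in> sets (lebesgue_on Y)} \<subseteq> sets ?R"
    using X Y XY by (auto simp: sets_restrict_space_iff intro!: sets_lebesgue_Times)
  have "sets (lebesgue_on X \<Otimes>\<^sub>M lebesgue_on Y) \<subseteq> sets ?R"
    unfolding sets_pair_measure
    using sets.sigma_sets_subset[OF eq] by (simp add: space_restrict_space)
  then show ?thesis using B XY by (auto simp: sets_restrict_space_iff)
qed

lemma sigma_finite_lebesgue: "sigma_finite_measure (lebesgue :: 'a::euclidean_space measure)"
proof
  obtain A :: "'a set set" where "countable A" "A \<subseteq> sets lborel" "\<Union>A = space lborel"
      "\<forall>a\<in>A. emeasure lborel a \<noteq> \<infinity>"
    using lborel.sigma_finite_countable by blast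
  then show "\<exists>A. countable A \<and> A \<subseteq> sets lebesgue \<and> \<Union>A = space lebesgue \<and>
      (\<forall>a\<in>A. emeasure (lebesgue :: 'a measure) a \<noteq> \<infinity>)"
    by (intro exI[of _ A]) (auto simp: subset_iff)
qed

text \<open>
  By Fubini for a Borel null set containing \<open>B\<close>, almost every vertical section of \<open>B\<close> is null.
\<close>

lemma null_sets_pair_lebesgue_on:
  fixes X :: "'a::euclidean_space set" and Y :: "'b::euclidean_space set"
  assumes X: "X \<in> sets lebesgue" and Y: "Y \<in> sets lebesgue"
    and B: "B \<in> sets (lebesgue_on X \<Otimes>\<^sub>M lebesgue_on Y)" and null: "negligible B"
  shows "B \<in> null_sets (lebesgue_on X \<Otimes>\<^sub>M lebesgue_on Y)"
proof -
  interpret Y: sigma_finite_measure "lebesgue_on Y"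
    by (rule sigma_finite_measure_restrict_space[OF sigma_finite_lebesgue Y])
  obtain N where N: "N \<in> null_sets lborel" "B \<subseteq> N"
    using null unfolding negligible_iff_null_sets null_sets_completion_iff2 by blast
  have "AE z in lborel \<Otimes>\<^sub>M lborel. z \<notin> N"
    unfolding lborel_prod using N(1) by (rule AE_not_in)
  then have "AE x in lborel. AE y in lborel. (x, y) \<notin> N"
    by (rule lborel_pair.AE_pair)
  then have *: "AE x in lebesgue. AE y in lebesgue. (x, y) \<notin> N"
    by (simp add: AE_completion_iff)
  then have "AE x in lebesgue_on X. emeasure (lebesgue_on Y) (Pair x -` B) = 0"
  proof (subst AE_restrict_space_iff, use X in simp, elim eventually_mono, intro impI)
    fix x assume x: "AE y in lebesgue. (x, y) \<notin> N"
    have "Pair x -` B \<in> sets (lebesgue_on Y)" using B by (rule sets_Pair1)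
    moreover have "AE y in lebesgue_on Y. y \<notin> Pair x -` B"
      using x N(2) Y by (subst AE_restrict_space_iff) (auto elim!: eventually_mono)
    ultimately show "emeasure (lebesgue_on Y) (Pair x -` B) = 0"
      using AE_iff_null_sets null_setsD1 by blast
  qed
  then have "(\<integral>\<^sup>+x. emeasure (lebesgue_on Y) (Pair x -` B) \<partial>lebesgue_on X) = (\<integral>\<^sup>+x. 0 \<partial>lebesgue_on X)"
    by (rule nn_integral_cong_AE)
  then show ?thesis
    using B by (intro null_setsI) (simp_all add: Y.emeasure_pair_measure_alt)
qed

lemma emeasure_lebesgue_Times_borel:
  fixes A :: "'a::euclidean_space set" and B :: "'b::euclidean_space set"
  assumes "A \<in> sets borel" "B \<in> sets borel"
  shows "emeasure lebesgue (A \<times> B) = emeasure lebesgue A * emeasure lebesgue B"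
proof -
  have "A \<times> B \<in> sets lborel" using assms by (simp add: borel_prod[symmetric])
  then show ?thesis using assms
    using lborel.emeasure_pair_measure_Times[of A lborel B] by (simp add: lborel_prod)
qed

section \<open>A counting inequality\<close>

text \<open>
  The bookkeeping behind the uniform constant.  By the pigeonhole principle some residue class
  contains at least \<open>card D / d\<close> elements of \<open>D\<close>, so a fixed proportion of the pairs are
  off-diagonal and congruent.  On each of them, averaging a pair with its transpose replaces the
  trivial bound \<open>q\<close> by \<open>q / 2\<close>.  The hypothesis on \<open>card D\<close> keeps the diagonal negligible: it
  forces the chosen class to have at least two elements.
\<close>

lemma sum_pairs_le_if_congruent_swap:
  fixes \<beta> :: "nat \<Rightarrow> nat \<Rightarrow> real"
  assumes D: "finite D" "2 * d \<le> card D" and d: "0 < d" and q: "0 \<le> q"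
    and le: "\<And>a b. a \<in> D \<Longrightarrow> b \<in> D \<Longrightarrow> \<beta> a b \<le> q"
    and swap: "\<And>a b. a \<in> D \<Longrightarrow> b \<in> D \<Longrightarrow> a \<noteq> b \<Longrightarrow> a mod d = b mod d \<Longrightarrow> \<beta> a b + \<beta> b a \<le> q"
  shows "(\<Sum>(a, b)\<in>D \<times> D. \<beta> a b) \<le> (1 - 1 / (4 * (real d)\<^sup>2)) * ((real (card D))\<^sup>2 * q)"
proof -
  define G where "G c = {a \<in> D. a mod d = c}" for c
  have "(\<Sum>c<d. card (G c)) = card D"
  proof -
    have "card (\<Union>c\<in>{..<d}. G c) = (\<Sum>c<d. card (G c))"
      by (rule card_UN_disjoint) (auto simp: G_def D)
    moreover have "(\<Union>c\<in>{..<d}. G c) = D" using d by (auto simp: G_def)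
    ultimately show ?thesis by simp
  qed
  moreover have "\<exists>c<d. card D \<le> d * card (G c)"
  proof (rule ccontr)
    assume "\<not> ?thesis"
    then have "(\<Sum>c<d. d * card (G c)) < (\<Sum>c<d. card D)"
      using d by (intro sum_strict_mono) auto
    then show False using calculation by (simp flip: sum_distrib_left)
  qed
  ultimately obtain c where c: "card D \<le> d * card (G c)" by blast
  let ?g = "real (card (G c))" and ?R = "real (card D)"
  have GD: "G c \<subseteq> D" "finite (G c)" using D by (auto simp: G_def)
  have Rg: "?R \<le> real d * ?g" using c by (metis of_nat_le_iff of_nat_mult)
  have "2 * d \<le> d * card (G c)" using c D(2) by linarith
  then have g2: "?g \<ge> 2" using d by (simp add: mult.commute)
  \<comment> \<open>The off-diagonal pairs inside the chosen residue class.\<close>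
  let ?E = "G c \<times> G c - (\<lambda>a. (a, a)) ` G c"
  have cardE: "real (card ?E) = ?g\<^sup>2 - ?g"
  proof -
    have "card ?E = card (G c \<times> G c) - card ((\<lambda>a. (a, a)) ` G c)"
      by (rule card_Diff_subset) (auto simp: GD)
    moreover have "card ((\<lambda>a. (a, a)) ` G c) = card (G c)"
      by (rule card_image) (auto simp: inj_on_def)
    moreover have "card (G c) \<le> card (G c) * card (G c)" by simp
    ultimately show ?thesis by (simp add: card_cartesian_product power2_eq_square of_nat_diff)
  qed
  have "2 * (\<Sum>(a, b)\<in>D \<times> D. \<beta> a b) = (\<Sum>(a, b)\<in>D \<times> D. \<beta> a b) + (\<Sum>(a, b)\<in>D \<times> D. \<beta> b a)"
    using sum.swap[of \<beta> D D] by (simp add: sum.cartesian_product[symmetric])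
  also have "\<dots> = (\<Sum>(a, b)\<in>D \<times> D. \<beta> a b + \<beta> b a)"
    by (simp add: sum.distrib split_def)
  also have "\<dots> \<le> (\<Sum>z\<in>D \<times> D. 2 * q - (if z \<in> ?E then q else 0))"
  proof (rule sum_mono, clarify)
    fix a b assume ab: "a \<in> D" "b \<in> D"
    show "\<beta> a b + \<beta> b a \<le> 2 * q - (if (a, b) \<in> ?E then q else 0)"
    proof (cases "(a, b) \<in> ?E")
      case True
      then have "a \<noteq> b" "a mod d = b mod d" by (auto simp: G_def image_iff)
      then show ?thesis using swap[OF ab] True by simp
    next
      case False
      then show ?thesis unfolding if_not_P[OF False] using le[OF ab] le[OF ab(2,1)] by simp
    qed
  qed
  also have "\<dots> = 2 * (?R\<^sup>2 * q) - real (card ?E) * q"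
  proof -
    have "D \<times> D \<inter> ?E = ?E" using GD by auto
    then have *: "(\<Sum>z\<in>D \<times> D. if z \<in> ?E then q else 0) = real (card ?E) * q"
      using sum.inter_restrict[of "D \<times> D" "\<lambda>_. q" ?E] D(1) by (simp only: finite_SigmaI sum_constant)
    show ?thesis
      unfolding sum_subtractf * by (simp add: card_cartesian_product power2_eq_square)
  qed
  finally have *: "2 * (\<Sum>(a, b)\<in>D \<times> D. \<beta> a b) \<le> 2 * (?R\<^sup>2 * q) - (?g\<^sup>2 - ?g) * q"
    unfolding cardE .
  have "?R\<^sup>2 \<le> (real d * ?g)\<^sup>2" using Rg by (intro power_mono) auto
  then have "?R\<^sup>2 / (real d)\<^sup>2 \<le> ?g\<^sup>2" using d by (simp add: field_simps)
  moreover have "?g\<^sup>2 / 2 \<le> ?g\<^sup>2 - ?g"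
    using mult_right_mono[OF g2, of ?g] by (simp add: power2_eq_square)
  ultimately have "?R\<^sup>2 / (2 * (real d)\<^sup>2) \<le> ?g\<^sup>2 - ?g" by simp
  then have "?R\<^sup>2 / (2 * (real d)\<^sup>2) * q \<le> (?g\<^sup>2 - ?g) * q"
    using q by (rule mult_right_mono)
  moreover have "(1 - 1 / (4 * (real d)\<^sup>2)) * (?R\<^sup>2 * q) = ?R\<^sup>2 * q - ?R\<^sup>2 / (2 * (real d)\<^sup>2) * q / 2"
    using d by (simp add: field_simps)
  moreover have "S \<le> U" if "2 * S \<le> 2 * V - E" "Y \<le> E" "U = V - Y / 2" for S U V E Y :: real
    using that by linarith
  ultimately show ?thesis using * by blast
qed

section \<open>Columns and their copies in later columns\<close>

lemma level_cut:
  assumes "0 < (r::nat)" "0 < w"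
  shows "level w x = (\<Union>k<r. level (w / real r) (x + real k * (w / real r)))"
proof (intro equalityI subsetI)
  fix y assume y: "y \<in> level w x"
  define v where "v = w / real r"
  have v: "0 < v" "real r * v = w" using assms by (auto simp: v_def)
  \<comment> \<open>Measured in units of the new width, \<open>y\<close> lies \<open>t\<close> units above \<open>x\<close>.\<close>
  define t where "t = (y - x) / v"
  have t: "0 \<le> t" "t < real r" "y = x + t * v"
    using y v by (auto simp: t_def level_def divide_simps mult.commute)
  define k where "k = nat \<lfloor>t\<rfloor>"
  have k: "real k \<le> t" "t < real k + 1" using t by (auto simp: k_def)
  then have "k < r" using t by linarith
  moreover have "real k * v \<le> t * v" "t * v < (real k + 1) * v"
    using k v by (auto intro!: mult_right_mono mult_strict_right_mono)
  then have "y \<in> level v (x + real k * v)"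
    unfolding t(3) level_def by (auto simp: algebra_simps)
  ultimately show "y \<in> (\<Union>k<r. level (w / real r) (x + real k * (w / real r)))"
    unfolding v_def by blast
next
  fix y assume "y \<in> (\<Union>k<r. level (w / real r) (x + real k * (w / real r)))"
  then obtain k where k: "k < r" "y \<in> level (w / real r) (x + real k * (w / real r))" by blast
  have "(real k + 1) * (w / real r) \<le> real r * (w / real r)"
    using assms k by (intro mult_right_mono) auto
  moreover have "0 \<le> real k * (w / real r)" using assms by simp
  moreover have "real r * (w / real r) = w" using assms by simp
  ultimately show "y \<in> level w x" using k(2) unfolding level_def distrib_right by auto
qed

text \<open>
  The \<open>k\<close>-th subcolumn appears in the new column as an uninterrupted run starting at some
  position \<open>a\<close>; the spacers only influence the value of \<open>a\<close>.
\<close>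

lemma cut_and_stack_subcolumn:
  assumes "k < r"
  obtains a where "\<And>i. i < length c \<Longrightarrow> i + a < length (cut_and_stack r w c sp) \<and>
    cut_and_stack r w c sp ! (i + a) = c ! i + real k * (w / real r)"
proof -
  let ?f = "\<lambda>k. map (\<lambda>a. a + real k * (w / real r)) c @ sp k"
  have "[0..<r] = [0..<k] @ k # [Suc k..<r]"
    using assms upt_add_eq_append[of 0 k "r - k"] by (simp add: upt_conv_Cons)
  then have *: "cut_and_stack r w c sp =
      concat (map ?f [0..<k]) @ map (\<lambda>a. a + real k * (w / real r)) c @
        (sp k @ concat (map ?f [Suc k..<r]))"
    unfolding cut_and_stack_def by simp
  show ?thesis
    by (rule that[of "length (concat (map ?f [0..<k]))"])
      (unfold * nth_append, simp)
qed

locale rank_one =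
  fixes r :: "nat \<Rightarrow> nat" and sp :: "nat \<Rightarrow> nat \<Rightarrow> real list"
  assumes construction: "rank_one_construction r sp"
begin

abbreviation "w \<equiv> width r"
abbreviation "C \<equiv> column r sp"
abbreviation "X \<equiv> rank_one_set r sp"

definition lev :: "nat \<Rightarrow> nat \<Rightarrow> real set" where
  "lev m i = level (w m) (C m ! i)"

lemma r_ge: "r m \<ge> 2"
  using construction by (simp add: rank_one_construction_def)

lemma r_pos: "0 < r m"
  using r_ge[of m] by linarith

lemma width_pos: "0 < w m"
  by (induction m) (auto simp: r_pos)

lemma width_halves: "2 ^ k * w (m + k) \<le> w m"
proof (induction k)
  case (Suc k)
  have "2 * w (m + Suc k) \<le> real (r (m + k)) * w (m + Suc k)"
    using r_ge[of "m + k"] width_pos[of "m + Suc k"] by (intro mult_right_mono) auto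
  also have "\<dots> = w (m + k)" using r_pos[of "m + k"] by simp
  finally have "2 ^ k * (2 * w (m + Suc k)) \<le> 2 ^ k * w (m + k)" by (intro mult_left_mono) auto
  moreover have "2 ^ Suc k * w (m + Suc k) = 2 ^ k * (2 * w (m + Suc k))"
    by (simp only: power_Suc mult.assoc mult.left_commute)
  ultimately show ?case using Suc by linarith
qed simp

lemma width_tendsto_0: "w \<longlonglongrightarrow> 0"
proof (rule tendsto_sandwich[of "\<lambda>_. 0" _ _ "\<lambda>m. (1 / 2) ^ m"])
  show "\<forall>\<^sub>F m in sequentially. 0 \<le> w m" using width_pos by (simp add: less_imp_le)
  show "\<forall>\<^sub>F m in sequentially. w m \<le> (1 / 2) ^ m"
    using width_halves[of _ 0] by (simp add: field_simps power_one_over)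
qed (auto intro: LIMSEQ_power_zero)

lemma lev_disjoint:
  "i < length (C m) \<Longrightarrow> j < length (C m) \<Longrightarrow> i \<noteq> j \<Longrightarrow> lev m i \<inter> lev m j = {}"
  using construction by (simp add: rank_one_construction_def disjoint_levels_def lev_def)

lemma support_eq: "column_support (w m) (C m) = (\<Union>i<length (C m). lev m i)"
  by (auto simp: column_support_def lev_def set_conv_nth)

lemma lev_borel: "lev m i \<in> sets borel"
  by (simp add: lev_def level_def)

lemma lev_lmeasurable: "lev m i \<in> lmeasurable" and measure_lev: "measure lebesgue (lev m i) = w m"
  using width_pos[of m] by (auto simp: lev_def level_def fmeasurable_def)

lemma X_lebesgue: "X \<in> sets lebesgue"
  unfolding rank_one_set_def support_eq using lev_borel by (auto intro!: sets.countable_UN)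

text \<open>
  Column \<open>N\<close> contains disjoint translated copies of column \<open>m\<close>, each occupying a run of
  consecutive levels; \<open>D\<close> is the set of positions at which the copies start.  Level \<open>i\<close> of
  column \<open>m\<close> is the union of the levels at height \<open>i\<close> in these copies.  It is essential that the
  same \<open>D\<close> serves all \<open>i\<close>: two levels of column \<open>m\<close> are then cut up in parallel.
\<close>

lemma copies:
  assumes "m \<le> N"
  obtains D where "finite D"
    "\<And>a. a \<in> D \<Longrightarrow> \<exists>t. \<forall>i<length (C m). i + a < length (C N) \<and> C N ! (i + a) = C m ! i + t"
    "\<And>i. i < length (C m) \<Longrightarrow> lev m i = (\<Union>a\<in>D. lev N (i + a))"
proof -
  have "\<exists>D. finite D \<and>
    (\<forall>a\<in>D. \<exists>t. \<forall>i<length (C m). i + a < length (C N) \<and> C N ! (i + a) = C m ! i + t) \<and>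
    (\<forall>i<length (C m). lev m i = (\<Union>a\<in>D. lev N (i + a)))"
    using assms
  proof (induction N rule: dec_induct)
    case base
    show ?case by (rule exI[of _ "{0}"]) auto
  next
    case (step N)
    then obtain D where D: "finite D"
      "\<forall>a\<in>D. \<exists>t. \<forall>i<length (C m). i + a < length (C N) \<and> C N ! (i + a) = C m ! i + t"
      "\<forall>i<length (C m). lev m i = (\<Union>a\<in>D. lev N (i + a))" by blast
    have "\<forall>k. \<exists>s. k < r N \<longrightarrow> (\<forall>i<length (C N). i + s < length (C (Suc N)) \<and>
        C (Suc N) ! (i + s) = C N ! i + real k * w (Suc N))"
      by (metis cut_and_stack_subcolumn column.simps(2) width.simps(2))
    then obtain s where s: "\<And>k i. k < r N \<Longrightarrow> i < length (C N) \<Longrightarrow>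
        i + s k < length (C (Suc N)) \<and> C (Suc N) ! (i + s k) = C N ! i + real k * w (Suc N)"
      by metis
    have cut: "lev N i = (\<Union>k<r N. lev (Suc N) (i + s k))" if "i < length (C N)" for i
      using level_cut[OF r_pos[of N] width_pos[of N]] s[OF _ that] by (simp add: lev_def)
    \<comment> \<open>The copies of column \<open>m\<close> sit inside the copies of column \<open>N\<close>, so starting positions add up.\<close>
    define D' where "D' = (\<lambda>(a, k). a + s k) ` (D \<times> {..<r N})"
    show ?case
    proof (intro exI[of _ D'] conjI allI impI ballI)
      show "finite D'" using D(1) by (simp add: D'_def)
      fix b assume "b \<in> D'"
      then obtain a k where b: "a \<in> D" "k < r N" "b = a + s k" by (auto simp: D'_def)
      obtain t where "\<forall>i<length (C m). i + a < length (C N) \<and> C N ! (i + a) = C m ! i + t"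
        using D(2) b(1) by blast
      then have "i + b < length (C (Suc N)) \<and>
          C (Suc N) ! (i + b) = C m ! i + (t + real k * w (Suc N))" if "i < length (C m)" for i
        using s[OF b(2), of "i + a"] b(3) that by (simp add: add.assoc del: column.simps width.simps)
      then show "\<exists>t. \<forall>i<length (C m). i + b < length (C (Suc N)) \<and> C (Suc N) ! (i + b) = C m ! i + t"
        by blast
    next
      fix i assume i: "i < length (C m)"
      have "lev m i = (\<Union>a\<in>D. \<Union>k<r N. lev (Suc N) (i + a + s k))"
      proof -
        have "lev N (i + a) = (\<Union>k<r N. lev (Suc N) (i + a + s k))" if "a \<in> D" for a
          using cut D(2) i that by blast
        then show ?thesis using D(3) i by simp
      qed
      also have "\<dots> = (\<Union>b\<in>D'. lev (Suc N) (i + b))"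
        by (force simp: D'_def add.assoc)
      finally show "lev m i = (\<Union>b\<in>D'. lev (Suc N) (i + b))" .
    qed
  qed
  then obtain D where "finite D"
    "\<forall>a\<in>D. \<exists>t. \<forall>i<length (C m). i + a < length (C N) \<and> C N ! (i + a) = C m ! i + t"
    "\<forall>i<length (C m). lev m i = (\<Union>a\<in>D. lev N (i + a))" by (elim exE conjE)
  then show ?thesis by (intro that[of D]) simp_all
qed

lemma card_copies:
  assumes "i < length (C m)" "finite D" "\<And>a. a \<in> D \<Longrightarrow> i + a < length (C N)"
    and "lev m i = (\<Union>a\<in>D. lev N (i + a))"
  shows "real (card D) * w N = w m"
proof -
  have "w m = measure lebesgue (\<Union>a\<in>D. lev N (i + a))"
    using assms(4) measure_lev[of m i] by simp
  also have "\<dots> = (\<Sum>a\<in>D. measure lebesgue (lev N (i + a)))"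
    using assms by (intro measure_UNION')
      (auto simp: lev_lmeasurable pairwise_def disjnt_def lev_disjoint)
  finally show ?thesis by (simp add: measure_lev)
qed

lemma support_mono:
  assumes "m \<le> N" shows "column_support (w m) (C m) \<subseteq> column_support (w N) (C N)"
proof
  fix x assume "x \<in> column_support (w m) (C m)"
  then obtain i where i: "i < length (C m)" "x \<in> lev m i" by (auto simp: support_eq)
  obtain D where D:
    "\<And>a. a \<in> D \<Longrightarrow> \<exists>t. \<forall>i<length (C m). i + a < length (C N) \<and> C N ! (i + a) = C m ! i + t"
    "\<And>i. i < length (C m) \<Longrightarrow> lev m i = (\<Union>a\<in>D. lev N (i + a))"
    using copies[OF assms] by metis
  obtain a where a: "a \<in> D" "x \<in> lev N (i + a)" using D(2)[OF i(1)] i(2) by blast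
  moreover have "i + a < length (C N)" using D(1)[OF a(1)] i(1) by blast
  ultimately show "x \<in> column_support (w N) (C N)" by (auto simp: support_eq)
qed

text \<open>
  Each copy of column \<open>m\<close> is a run of consecutive levels, so the later column map moves a point
  of a copy by the same translation; only the top level of column \<open>m\<close> gains new images.
\<close>

lemma column_map_mono:
  assumes "m \<le> N" shows "column_map (w m) (C m) \<subseteq> column_map (w N) (C N)"
proof clarify
  fix x y assume "(x, y) \<in> column_map (w m) (C m)"
  then obtain j where j: "Suc j < length (C m)" "x \<in> lev m j" "y = x + (C m ! Suc j - C m ! j)"
    by (auto simp: column_map_def lev_def)
  obtain D where D:
    "\<And>a. a \<in> D \<Longrightarrow> \<exists>t. \<forall>i<length (C m). i + a < length (C N) \<and> C N ! (i + a) = C m ! i + t"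
    "\<And>i. i < length (C m) \<Longrightarrow> lev m i = (\<Union>a\<in>D. lev N (i + a))"
    using copies[OF assms] by metis
  obtain a where a: "a \<in> D" "x \<in> lev N (j + a)" using D(2)[of j] j by auto
  obtain t where t: "\<forall>i<length (C m). i + a < length (C N) \<and> C N ! (i + a) = C m ! i + t"
    using D(1) a(1) by blast
  have "Suc (j + a) < length (C N)" "C N ! Suc (j + a) - C N ! (j + a) = C m ! Suc j - C m ! j"
    using t j(1) Suc_lessD[OF j(1)] by (auto dest!: spec[of _ "Suc j"])
  then show "(x, y) \<in> column_map (w N) (C N)"
    using a(2) j(3) unfolding column_map_def lev_def by force
qed

lemma column_map_functional:
  assumes "(x, y) \<in> column_map (w m) (C m)" "(x, z) \<in> column_map (w m) (C m)"
  shows "y = z"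
proof -
  obtain i j where "Suc i < length (C m)" "x \<in> lev m i" "y = x + (C m ! Suc i - C m ! i)"
     "Suc j < length (C m)" "x \<in> lev m j" "z = x + (C m ! Suc j - C m ! j)"
    using assms unfolding column_map_def lev_def by blast
  then show ?thesis using lev_disjoint[of i m j] by (cases "i = j") auto
qed

end

section \<open>Powers of the transformation as translations between levels\<close>

text \<open>
  If \<open>F\<close> almost surely moves each level of a finite chain onto the next one by translation, then
  so do its iterates: translations preserve null sets, so the exceptional sets of the later steps
  can be pulled back to the first level.
\<close>

lemma AE_funpow_translate:
  fixes F :: "real \<Rightarrow> real" and b :: "nat \<Rightarrow> real"
  assumes "\<And>j. j < k \<Longrightarrow> AE x in lebesgue. x \<in> level v (b j) \<longrightarrow> F x = x + (b (Suc j) - b j)"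
  shows "AE x in lebesgue. x \<in> level v (b 0) \<longrightarrow> (F ^^ k) x = x + (b k - b 0)"
  using assms
proof (induction k)
  case (Suc k)
  have "AE x in lebesgue. x \<in> level v (b 0) \<longrightarrow> (F ^^ k) x = x + (b k - b 0)"
    using Suc by simp
  moreover have "AE x in lebesgue. x + (b k - b 0) \<in> level v (b k) \<longrightarrow>
      F (x + (b k - b 0)) = x + (b k - b 0) + (b (Suc k) - b k)"
    using Suc.prems[of k] by (intro AE_lebesgue_translate[where P = "\<lambda>x. x \<in> level v (b k) \<longrightarrow> F x = x + (b (Suc k) - b k)"]) simp
  ultimately show ?case
  proof eventually_elim
    case (elim x)
    show ?case
    proof
      assume "x \<in> level v (b 0)"
      moreover from this have "x + (b k - b 0) \<in> level v (b k)" by (auto simp: level_def)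
      ultimately show "(F ^^ Suc k) x = x + (b (Suc k) - b 0)" using elim by simp
    qed
  qed
qed simp

lemma int_iterate_funpow: "int_iterate T T' n ^^ k = int_iterate T T' (n * int k)"
proof (cases "n \<ge> 0")
  case True
  then show ?thesis by (simp add: int_iterate_def funpow_mult nat_mult_distrib)
next
  case False
  have "nat (- (n * int k)) = nat (- n) * k"
    using False nat_mult_distrib[of "- n" "int k"] by simp
  moreover have "n * int k \<ge> 0 \<longleftrightarrow> k = 0" using False by (auto simp: zero_le_mult_iff)
  ultimately show ?thesis using False by (auto simp: int_iterate_def funpow_mult)
qed

lemma map_prod_funpow:
  fixes f :: "'a \<Rightarrow> 'a" and g :: "'b \<Rightarrow> 'b"
  shows "map_prod f g ^^ k = map_prod (f ^^ k) (g ^^ k)"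
  by (induction k) (auto simp: fun_eq_iff)

lemma measurable_funpow: "(f :: 'a \<Rightarrow> 'a) \<in> M \<rightarrow>\<^sub>M M \<Longrightarrow> f ^^ k \<in> M \<rightarrow>\<^sub>M M"
  by (induction k) (auto intro: measurable_comp)

locale rank_one_system = rank_one r sp for r sp +
  fixes T T' :: "real \<Rightarrow> real"
  assumes transformation: "rank_one_transformation r sp T"
    and inverse: "inverse_mod_null (rank_one_space r sp) T T'"
begin

lemma lev_subset_X: "i < length (C m) \<Longrightarrow> lev m i \<subseteq> X"
  unfolding rank_one_set_def support_eq by blast

lemma T_step:
  assumes "Suc p < length (C N)"
  shows "AE x in lebesgue. x \<in> lev N p \<longrightarrow> T x = x + (C N ! Suc p - C N ! p)"
proof -
  have "AE x in lebesgue_on X. \<forall>\<^sub>F m in sequentially. (x, T x) \<in> column_map (w m) (C m)"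
    using transformation by (simp add: rank_one_transformation_def)
  then have "AE x in lebesgue. x \<in> X \<longrightarrow> (\<forall>\<^sub>F m in sequentially. (x, T x) \<in> column_map (w m) (C m))"
    using X_lebesgue by (subst (asm) AE_restrict_space_iff) auto
  then show ?thesis
  proof eventually_elim
    case (elim x)
    show ?case
    proof
      assume x: "x \<in> lev N p"
      then have "x \<in> X" using lev_subset_X[of p N] assms by auto
      then obtain m0 where "\<forall>m\<ge>m0. (x, T x) \<in> column_map (w m) (C m)"
        using elim by (auto simp: eventually_sequentially)
      then have m: "N \<le> max N m0" "(x, T x) \<in> column_map (w (max N m0)) (C (max N m0))"
        by auto
      have "(x, x + (C N ! Suc p - C N ! p)) \<in> column_map (w N) (C N)"
        using x assms unfolding column_map_def lev_def by blast
      then show "T x = x + (C N ! Suc p - C N ! p)"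
        using column_map_mono[OF m(1)] column_map_functional[OF m(2)] by blast
    qed
  qed
qed

text \<open>
  Almost every point of the upper level is \<open>T x\<close> for some \<open>x\<close> with \<open>T' (T x) = x\<close>, because
  \<open>T\<close> maps the lower level onto it by a translation up to null sets; this determines \<open>T'\<close> there.
\<close>

lemma T'_step:
  assumes "Suc p < length (C N)"
  shows "AE y in lebesgue. y \<in> lev N (Suc p) \<longrightarrow> T' y = y + (C N ! p - C N ! Suc p)"
proof -
  let ?d = "C N ! Suc p - C N ! p"
  have "AE x in lebesgue_on X. T' (T x) = x"
    using inverse by (simp add: inverse_mod_null_def)
  then have "AE x in lebesgue. x \<in> X \<longrightarrow> T' (T x) = x"
    using X_lebesgue by (subst (asm) AE_restrict_space_iff) auto
  with T_step[OF assms] have "AE x in lebesgue. x \<in> lev N p \<longrightarrow> T' (x + ?d) = x"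
  proof eventually_elim
    case (elim x)
    then show ?case using lev_subset_X[of p N] assms by (metis Suc_lessD subsetD)
  qed
  from AE_lebesgue_translate[OF this, of "- ?d"] show ?thesis
  proof eventually_elim
    case (elim y)
    then show ?case by (auto simp: lev_def level_def)
  qed
qed

text \<open>
  Within column \<open>N\<close>, all powers of \<open>T\<close>, forwards or backwards, act almost surely as the
  translation between the two levels concerned.
\<close>

lemma int_iterate_on_level:
  assumes "p < length (C N)" "q < length (C N)"
  shows "AE x in lebesgue. x \<in> lev N p \<longrightarrow>
    int_iterate T T' (int q - int p) x = x + (C N ! q - C N ! p)"
proof (cases "p \<le> q")
  case True
  have "AE x in lebesgue. x \<in> level (w N) (C N ! (p + 0)) \<longrightarrow>
      (T ^^ (q - p)) x = x + (C N ! (p + (q - p)) - C N ! (p + 0))"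
    by (rule AE_funpow_translate)
      (use T_step assms in \<open>simp add: lev_def[symmetric]\<close>)
  moreover have "nat (int q - int p) = q - p" by simp
  ultimately show ?thesis using True by (simp add: int_iterate_def lev_def)
next
  case False
  have "AE x in lebesgue. x \<in> level (w N) (C N ! (p - 0)) \<longrightarrow>
      (T' ^^ (p - q)) x = x + (C N ! (p - (p - q)) - C N ! (p - 0))"
  proof (rule AE_funpow_translate)
    fix j assume j: "j < p - q"
    then have "p - j = Suc (p - Suc j)" by simp
    then show "AE x in lebesgue. x \<in> level (w N) (C N ! (p - j)) \<longrightarrow>
        T' x = x + (C N ! (p - Suc j) - C N ! (p - j))"
      using T'_step[of "p - Suc j" N] assms(1) by (simp add: lev_def)
  qed
  moreover have "nat (int p - int q) = p - q" by simp
  ultimately show ?thesis using False by (simp add: int_iterate_def lev_def)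
qed

lemma int_iterate_measurable:
  "int_iterate T T' n \<in> rank_one_space r sp \<rightarrow>\<^sub>M rank_one_space r sp"
  using transformation inverse
  by (simp add: int_iterate_def measurable_funpow rank_one_transformation_def inverse_mod_null_def)

section \<open>Sets without returns\<close>

abbreviation "prod_map n \<equiv> map_prod (int_iterate T T' n) (int_iterate T T' (- n))"

lemma prod_map_funpow: "prod_map n ^^ k = prod_map (n * int k)"
  by (simp add: map_prod_funpow int_iterate_funpow)

abbreviation "rect m i j \<equiv> lev m i \<times> lev m j"

lemma rect_lmeasurable: "rect m i j \<in> lmeasurable"
  and measure_rect: "measure lebesgue (rect m i j) = (w m)\<^sup>2"
proof -
  have "emeasure lebesgue (lev m i) = ennreal (w m)" for i
    using emeasure_eq_measure2[OF lev_lmeasurable] by (simp add: measure_lev)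
  then have e: "emeasure lebesgue (rect m i j) = ennreal ((w m)\<^sup>2)"
    using width_pos[of m]
    by (simp add: emeasure_lebesgue_Times_borel[OF lev_borel lev_borel] power2_eq_square ennreal_mult)
  moreover have "rect m i j \<in> sets lebesgue"
    by (rule sets_lebesgue_Times) (use lev_lmeasurable in \<open>auto simp: fmeasurable_def\<close>)
  ultimately show "rect m i j \<in> lmeasurable" by (simp add: fmeasurable_def)
  show "measure lebesgue (rect m i j) = (w m)\<^sup>2" using e by (simp add: measure_def)
qed

text \<open>
  The heart of the argument.  When the distance \<open>b - a\<close> of two copies is \<open>n k\<close>, the \<open>k\<close>-th
  iterate raises the first coordinate from copy \<open>a\<close> to copy \<open>b\<close> and lowers the second from copy
  \<open>b\<close> to copy \<open>a\<close>, thus translating the rectangle \<open>(a, b)\<close> onto the rectangle \<open>(b, a)\<close>.  The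
  image of the part of \<open>B\<close> in the former must avoid the part of \<open>B\<close> in the latter, so both parts
  fit into a single rectangle.
\<close>

lemma wandering_swap:
  assumes B: "B \<in> lmeasurable" and wander: "\<And>z k. z \<in> B \<Longrightarrow> 1 \<le> k \<Longrightarrow> (prod_map n ^^ k) z \<notin> B"
    and len: "i + a < length (C N)" "i + b < length (C N)" "j + a < length (C N)" "j + b < length (C N)"
    and k: "int b - int a = n * int k" "1 \<le> k"
  shows "measure lebesgue (B \<inter> rect N (i + a) (j + b)) +
         measure lebesgue (B \<inter> rect N (i + b) (j + a)) \<le> (w N)\<^sup>2"
proof -
  let ?Q = "rect N (i + a) (j + b)" and ?Q' = "rect N (i + b) (j + a)"
  define \<tau> where "\<tau> = (C N ! (i + b) - C N ! (i + a), C N ! (j + a) - C N ! (j + b))"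
  have ae: "AE z in lebesgue. z \<in> ?Q \<longrightarrow> (prod_map n ^^ k) z = \<tau> + z"
  proof -
    have eq: "int (i + b) - int (i + a) = n * int k" "int (j + a) - int (j + b) = - (n * int k)"
      using k(1) by simp_all
    from AE_lebesgue_prod[OF int_iterate_on_level[OF len(1,2)] int_iterate_on_level[OF len(4,3)]]
    show ?thesis
      unfolding prod_map_funpow eq
      by eventually_elim (auto simp: \<tau>_def)
  qed
  define E where "E = {z. \<not> (z \<in> ?Q \<longrightarrow> (prod_map n ^^ k) z = \<tau> + z)}"
  have E: "E \<in> null_sets lebesgue"
    using ae by (simp add: E_def AE_lebesgue_negligible negligible_iff_null_sets)
  define B' where "B' = (+) \<tau> ` (B \<inter> ?Q - E)"
  have BQ: "B \<inter> ?Q \<in> lmeasurable" "B \<inter> ?Q' \<in> lmeasurable"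
    using B rect_lmeasurable by (auto intro: fmeasurable.Int)
  then have "B \<inter> ?Q - E \<in> lmeasurable"
    using E by (intro fmeasurable_Diff) auto
  then have B'm: "B' \<in> lmeasurable"
    unfolding B'_def by (rule measurable_translation)
  have "measure lebesgue B' = measure lebesgue (B \<inter> ?Q)"
    unfolding B'_def measure_translation
    by (rule measure_Diff_null_set) (use BQ E in auto)
  moreover have "B' \<inter> (B \<inter> ?Q') = {}"
    using wander[OF _ k(2)] by (auto simp: B'_def E_def) metis
  then have "measure lebesgue (B' \<union> (B \<inter> ?Q')) = measure lebesgue B' + measure lebesgue (B \<inter> ?Q')"
    using B'm BQ(2)
    by (intro measure_Union) (simp_all only: fmeasurableD fmeasurableD2 infinity_ennreal_def not_False_eq_True)
  moreover have "B' \<union> (B \<inter> ?Q') \<subseteq> ?Q'"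
    by (auto simp: B'_def \<tau>_def lev_def level_def)
  then have "measure lebesgue (B' \<union> (B \<inter> ?Q')) \<le> measure lebesgue ?Q'"
    using B'm BQ rect_lmeasurable by (intro measure_mono_fmeasurable) auto
  ultimately show ?thesis by (simp add: measure_rect)
qed

text \<open>
  The rectangle is cut according to the copies of column \<open>m\<close> in a later column, and the small
  rectangles are paired off by \<open>wandering_swap\<close>.  The resulting constant depends on \<open>n\<close> only, so
  that it survives the passage to ever smaller rectangles.
\<close>

lemma wandering_sparse:
  assumes n: "n \<noteq> 0" and B: "B \<in> lmeasurable"
    and wander: "\<And>z k. z \<in> B \<Longrightarrow> 1 \<le> k \<Longrightarrow> (prod_map n ^^ k) z \<notin> B"
    and ij: "i < length (C m)" "j < length (C m)"
  shows "measure lebesgue (B \<inter> rect m i j) \<le>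
    (1 - 1 / (4 * (real (nat \<bar>n\<bar>))\<^sup>2)) * measure lebesgue (rect m i j)"
proof -
  define d where "d = nat \<bar>n\<bar>"
  have d: "0 < d" "int d = \<bar>n\<bar>" using n by (auto simp: d_def)
  \<comment> \<open>Since every cut at least doubles the number of copies, \<open>2 d\<close> further stages give at least \<open>2 d\<close> copies.\<close>
  define N where "N = m + 2 * d"
  obtain D where D: "finite D"
    "\<And>a. a \<in> D \<Longrightarrow> \<exists>t. \<forall>i<length (C m). i + a < length (C N) \<and> C N ! (i + a) = C m ! i + t"
    "\<And>i. i < length (C m) \<Longrightarrow> lev m i = (\<Union>a\<in>D. lev N (i + a))"
    using copies[of m N] unfolding N_def by (metis le_add1)
  have len: "i + a < length (C N)" if "a \<in> D" "i < length (C m)" for a i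
    using D(2)[OF that(1)] that(2) by blast
  have cw: "real (card D) * w N = w m"
    using card_copies[OF ij(1) D(1) len[OF _ ij(1)] D(3)[OF ij(1)]] .
  have "2 ^ (2 * d) * w N \<le> real (card D) * w N"
    unfolding cw by (simp add: N_def width_halves)
  then have "(2::real) ^ (2 * d) \<le> real (card D)"
    using width_pos[of N] by simp
  moreover have "real (2 * d) < 2 ^ (2 * d)" by (rule of_nat_less_two_power)
  ultimately have cD: "2 * d \<le> card D" by linarith
  define \<beta> where "\<beta> a b = measure lebesgue (B \<inter> rect N (i + a) (j + b))" for a b
  have "measure lebesgue (B \<inter> rect m i j) =
      measure lebesgue (\<Union>(a, b)\<in>D \<times> D. B \<inter> rect N (i + a) (j + b))"
    using D(3) ij by (intro arg_cong[where f = "measure lebesgue"]) auto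
  also have "\<dots> \<le> (\<Sum>(a, b)\<in>D \<times> D. \<beta> a b)"
    unfolding \<beta>_def split_def
    by (rule measure_UNION_le) (use D(1) B rect_lmeasurable in \<open>auto intro!: sets.Int fmeasurableD\<close>)
  also have "\<dots> \<le> (1 - 1 / (4 * (real d)\<^sup>2)) * ((real (card D))\<^sup>2 * (w N)\<^sup>2)"
  proof (rule sum_pairs_le_if_congruent_swap)
    fix a b assume "a \<in> D" "b \<in> D"
    have "\<beta> a b \<le> measure lebesgue (rect N (i + a) (j + b))"
      unfolding \<beta>_def using B rect_lmeasurable
      by (intro measure_mono_fmeasurable) (auto intro!: sets.Int fmeasurableD)
    then show "\<beta> a b \<le> (w N)\<^sup>2" by (simp add: measure_rect)
  next
    fix a b assume ab: "a \<in> D" "b \<in> D" "a \<noteq> b" "a mod d = b mod d"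
    have "int a mod int d = int b mod int d" using ab(4) by (metis zmod_int)
    then have "int d dvd int b - int a" by (metis mod_eq_dvd_iff)
    then have "n dvd int b - int a" unfolding d(2) by simp
    then obtain l where l: "int b - int a = n * l" by blast
    show "\<beta> a b + \<beta> b a \<le> (w N)\<^sup>2"
    \<comment> \<open>For negative \<open>l\<close> the iterate carries the rectangle \<open>(b, a)\<close> onto \<open>(a, b)\<close> instead.\<close>
    proof (cases "l \<ge> 0")
      case True
      then have "l \<noteq> 0" using l ab(3) by auto
      then have "int b - int a = n * int (nat l)" "1 \<le> nat l" using True l by auto
      then show ?thesis unfolding \<beta>_def
        using wandering_swap[OF B wander len len len len] ab ij by blast
    next
      case False
      then have "int a - int b = n * int (nat (- l))" "1 \<le> nat (- l)"
        using l by (auto simp: algebra_simps)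
      then have "\<beta> b a + \<beta> a b \<le> (w N)\<^sup>2" unfolding \<beta>_def
        using wandering_swap[OF B wander len len len len] ab ij by blast
      then show ?thesis by simp
    qed
  qed (use D(1) cD d in auto)
  also have "(real (card D))\<^sup>2 * (w N)\<^sup>2 = measure lebesgue (rect m i j)"
    unfolding measure_rect cw[symmetric] by (simp add: power_mult_distrib)
  finally show ?thesis unfolding d_def .
qed

lemma rects_fine:
  assumes U: "open U" "z \<in> U" and z: "z \<in> X \<times> X"
  shows "\<forall>\<^sub>F m in sequentially. \<exists>i<length (C m). \<exists>j<length (C m). z \<in> rect m i j \<and> rect m i j \<subseteq> U"
proof -
  obtain x y where xy: "z = (x, y)" by (cases z)
  obtain e where e: "e > 0" "ball z e \<subseteq> U" using U by (meson open_contains_ball)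
  have ev: "\<forall>\<^sub>F m in sequentially. x \<in> column_support (w m) (C m)" if "x \<in> X" for x
    using that support_mono unfolding rank_one_set_def eventually_sequentially by blast
  have "\<forall>\<^sub>F m in sequentially. w m < e / 2"
    using order_tendstoD(2)[OF width_tendsto_0, of "e / 2"] e(1) by simp
  moreover have "\<forall>\<^sub>F m in sequentially. x \<in> column_support (w m) (C m)"
      "\<forall>\<^sub>F m in sequentially. y \<in> column_support (w m) (C m)"
    using z xy by (auto intro: ev)
  ultimately show ?thesis
  proof eventually_elim
    case (elim m)
    then obtain i j where ij: "i < length (C m)" "x \<in> lev m i" "j < length (C m)" "y \<in> lev m j"
      by (auto simp: support_eq)
    have "rect m i j \<subseteq> ball z e"
    proof clarify
      fix x' y' assume "x' \<in> lev m i" "y' \<in> lev m j"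
      then have "dist x x' < e / 2" "dist y y' < e / 2"
        using ij elim(1) unfolding lev_def level_def dist_real_def atLeastLessThan_iff
        by linarith+
      then have "dist (x, y) (x', y') < e"
        using sqrt_sum_squares_le_sum[of "dist x x'" "dist y y'"] by (simp add: dist_Pair_Pair)
      then show "(x', y') \<in> ball z e" by (simp add: xy)
    qed
    then show ?case using ij e(2) xy by blast
  qed
qed

lemma wandering_negligible:
  assumes n: "n \<noteq> 0" and B: "B \<in> sets lebesgue" "B \<subseteq> X \<times> X"
    and wander: "\<And>z k. z \<in> B \<Longrightarrow> 1 \<le> k \<Longrightarrow> (prod_map n ^^ k) z \<notin> B"
  shows "negligible B"
proof -
  have "negligible (B \<inter> cball 0 (real l))" for l
  proof (rule negligible_if_uniformly_sparse)
    let ?Q = "\<lambda>m. (\<lambda>(i, j). rect m i j) ` ({..<length (C m)} \<times> {..<length (C m)})"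
    show Bl: "B \<inter> cball 0 (real l) \<in> lmeasurable"
      using B(1) by (intro bounded_set_imp_lmeasurable bounded_Int) auto
    show "finite (?Q m)" for m by simp
    show "K \<in> lmeasurable" if "K \<in> ?Q m" for m K
      using that rect_lmeasurable by auto
    show "pairwise disjnt (?Q m)" for m
    proof (rule pairwiseI)
      fix K L assume KL: "K \<in> ?Q m" "L \<in> ?Q m" "K \<noteq> L"
      then obtain i j i' j' where "K = rect m i j" "L = rect m i' j'"
        "i < length (C m)" "j < length (C m)" "i' < length (C m)" "j' < length (C m)" by auto
      then show "disjnt K L"
        using KL(3) lev_disjoint[of i m i'] lev_disjoint[of j m j']
        by (auto simp: disjnt_def)
    qed
    show "\<forall>\<^sub>F m in sequentially. \<exists>K\<in>?Q m. z \<in> K \<and> K \<subseteq> U"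
      if "open U" "z \<in> U" "z \<in> B \<inter> cball 0 (real l)" for U z
    proof -
      have "z \<in> X \<times> X" using that(3) B(2) by blast
      from rects_fine[OF that(1,2) this] show ?thesis
        by eventually_elim auto
    qed
    show "measure lebesgue (B \<inter> cball 0 (real l) \<inter> K) \<le>
        (1 - 1 / (4 * (real (nat \<bar>n\<bar>))\<^sup>2)) * measure lebesgue K" if "K \<in> ?Q m" for m K
      using that wandering_sparse[OF n Bl] wander by auto
    have "(1::real) \<le> (real (nat \<bar>n\<bar>))\<^sup>2" using n by (intro one_le_power) linarith
    moreover have "0 \<le> 1 - 1 / (4 * s)" "1 - 1 / (4 * s) < 1" if "1 \<le> s" for s :: real
      using that by (simp_all add: field_simps)
    ultimately show "0 \<le> 1 - 1 / (4 * (real (nat \<bar>n\<bar>))\<^sup>2)"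
      "1 - 1 / (4 * (real (nat \<bar>n\<bar>))\<^sup>2) < 1" by blast+
  qed
  then have "negligible (\<Union>l. B \<inter> cball 0 (real l))" by (intro negligible_Union_nat)
  moreover have "B \<subseteq> (\<Union>l. B \<inter> cball 0 (real l))" using real_arch_simple by auto
  ultimately show ?thesis by (rule negligible_subset)
qed

end

section \<open>Conservativity\<close>

theorem theorem4p3:
  fixes r :: "nat \<Rightarrow> nat"
    and sp :: "nat \<Rightarrow> nat \<Rightarrow> real list"
    and T T' :: "real \<Rightarrow> real"
    and n :: int
  assumes "rank_one_transformation r sp T"
    and "inverse_mod_null (rank_one_space r sp) T T'"
    and "n \<noteq> 0"
  shows "conservative (rank_one_space r sp \<Otimes>\<^sub>M rank_one_space r sp)
           (map_prod (int_iterate T T' n) (int_iterate T T' (- n)))"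
proof -
  interpret rank_one_system r sp T T'
    using assms by unfold_locales (auto simp: rank_one_transformation_def)
  let ?M = "rank_one_space r sp \<Otimes>\<^sub>M rank_one_space r sp"
  have "prod_map n \<in> ?M \<rightarrow>\<^sub>M ?M"
    unfolding map_prod_def split_def
    by (intro measurable_Pair measurable_compose[OF measurable_fst int_iterate_measurable]
        measurable_compose[OF measurable_snd int_iterate_measurable])
  then have meas: "prod_map n ^^ k \<in> ?M \<rightarrow>\<^sub>M ?M" for k by (rule measurable_funpow)
  show ?thesis
    unfolding conservative_def
  proof
    fix A assume A: "A \<in> sets ?M"
    \<comment> \<open>No point of this set ever returns to it, so it has to be null.\<close>
    let ?B = "A - (\<Union>k\<in>{1..}. (prod_map n ^^ k) -` A \<inter> space ?M)"
    have B: "?B \<in> sets ?M"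
      using A meas by (intro sets.Diff sets.countable_UN') (auto intro: measurable_sets)
    have sub: "?B \<subseteq> X \<times> X"
      using sets.sets_into_space[OF A] by (auto simp: space_pair_measure)
    have "negligible ?B"
    proof (rule wandering_negligible[OF assms(3) _ sub])
      show "?B \<in> sets lebesgue" by (rule sets_pair_lebesgue_on[OF X_lebesgue X_lebesgue B])
      show "(prod_map n ^^ k) z \<notin> ?B" if "z \<in> ?B" "1 \<le> k" for z k
        using that sets.sets_into_space[OF A] by auto
    qed
    then show "?B \<in> null_sets ?M"
      by (rule null_sets_pair_lebesgue_on[OF X_lebesgue X_lebesgue B])
  qed
qed

end
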